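(* For every positive integer $n$ and every $i\in\{1,\dots,n\}$, $\frac{n-i+1}{2}\le \beta_i(n)\le n-i+1$.
   Context: For a positive integer $n$, $[n]=\{1,\dots,n\}$. For a set $D$ of integers and families $\mathcal{F},\mathcal{F}'$ of subsets of $[n]$, $\mathcal{F}'$ is called $D$-secting for $\mathcal{F}$ if for every $A\in\mathcal{F}$ there exists $A'\in\mathcal{F}'$ with $|A\cap A'|-|A\cap([n]\setminus A')|\in D$. $\beta_D(\mathcal{F})$ denotes the minimum cardinality of a $D$-secting family for $\mathcal{F}$, and $\beta_i(\mathcal{F})=\beta_D(\mathcal{F})$ for $D=\{i\}$. Since $|A\cap A'|-|A\cap([n]\setminus A')|$ has the parity of $|A|$ and absolute value at most $|A|$, only sets $A$ with $|A|\equiv i \pmod 2$ and $|A|\ge i$ can be $\{i\}$-sected; accordingly $\beta_i(n)$ is the maximum of $\beta_i(\mathcal{F})$ over all families $\mathcal{F}$ of subsets $A\subseteq[n]$ with $|A|\equiv i\pmod 2$ and $|A|\ge i$. *)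

theory Defs
  imports Complex_Main
begin

definition secting :: "nat \<Rightarrow> int set \<Rightarrow> nat set set \<Rightarrow> nat set set \<Rightarrow> bool" where
  "secting n D F F' \<longleftrightarrow> F' \<subseteq> Pow {1..n} \<and>
     (\<forall>A\<in>F. \<exists>A'\<in>F'. int (card (A \<inter> A')) - int (card (A \<inter> ({1..n} - A'))) \<in> D)"

text \<open>The value is meaningful only if some secting family exists; see \<open>secting_Pow\<close>
  for the families used below.\<close>

definition beta :: "nat \<Rightarrow> int set \<Rightarrow> nat set set \<Rightarrow> nat" where
  "beta n D F = Min {card F' | F'. secting n D F F'}"

definition admissible :: "nat \<Rightarrow> nat \<Rightarrow> nat set set" where
  "admissible n i = {A. A \<subseteq> {1..n} \<and> card A mod 2 = i mod 2 \<and> i \<le> card A}"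

definition beta_max :: "nat \<Rightarrow> nat \<Rightarrow> nat" where
  "beta_max n i = Max {beta n {int i} F | F. F \<subseteq> admissible n i}"

lemma finite_secting_cards: "finite {card F' | F'. secting n D F F'}"
proof -
  have "{card F' | F'. secting n D F F'} \<subseteq> card ` Pow (Pow {1..n})"
    by (auto simp: secting_def)
  then show ?thesis by (rule finite_subset) simp
qed

lemma finite_beta_values: "finite {beta n {int i} F | F. F \<subseteq> admissible n i}"
proof -
  have "{beta n {int i} F | F. F \<subseteq> admissible n i} \<subseteq> beta n {int i} ` Pow (Pow {1..n})"
    by (auto simp: admissible_def)
  then show ?thesis by (rule finite_subset) simp
qed

lemma secting_Pow:
  assumes "F \<subseteq> admissible n i"
  shows "secting n {int i} F (Pow {1..n})"
  unfolding secting_def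
proof (intro conjI ballI)
  fix A assume "A \<in> F"
  then have A: "A \<subseteq> {1..n}" "card A mod 2 = i mod 2" "i \<le> card A"
    using assms by (auto simp: admissible_def)
  have fin: "finite A" using A(1) finite_subset by blast
  have "(card A + i) div 2 \<le> card A" using A(3) by linarith
  then obtain B where B: "B \<subseteq> A" "card B = (card A + i) div 2"
    by (meson obtain_subset_with_card_n)
  have AB: "A \<inter> B = B" "A \<inter> ({1..n} - B) = A - B" using A(1) B(1) by auto
  have "card (A - B) = card A - card B"
    using B(1) fin finite_subset by (meson card_Diff_subset)
  moreover have "2 * ((card A + i) div 2) = card A + i" using A(2) by presburger
  ultimately have "int (card B) - int (card (A - B)) = int i"
    using B(2) A(3) by linarith
  then show "\<exists>A'\<in>Pow {1..n}. int (card (A \<inter> A')) - int (card (A \<inter> ({1..n} - A'))) \<in> {int i}"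
    using AB A(1) B(1) by (intro bexI[of _ B]) auto
qed simp

end

theory Submission
  imports Defs
begin

text \<open>
  Upper bound: as \<open>j\<close> grows, \<open>card (A \<inter> {1..j})\<close> increases from \<open>0\<close> to \<open>card A\<close> in steps of at
  most one, so it equals \<open>(card A + i) / 2\<close> for some \<open>j\<close>, and then \<open>j \<ge> (card A + i) / 2 \<ge> i\<close>.
  Hence the initial segments \<open>{1..j}\<close> with \<open>i \<le> j \<le> n\<close> suffice.

  Lower bound: let \<open>F'\<close> be secting for all admissible sets and consider only the sets
  \<open>{1..i-1} \<union> S\<close> with \<open>S \<subseteq> {i..n}\<close>; such a set is admissible as soon as \<open>card S\<close> is odd. The square
  of the product over \<open>F'\<close> of the affine functions (discrepancy minus \<open>i\<close>) vanishes for odd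
  \<open>card S\<close>, is nonnegative for even \<open>card S\<close> and positive for \<open>S = {}\<close>, so its alternating sum over
  the cube of dimension \<open>n - i + 1\<close> is nonzero. An alternating sum over a cube annihilates every
  polynomial of degree below the dimension, so \<open>2 * card F' \<ge> n - i + 1\<close>.
\<close>

text \<open>Toggling one fixed element of \<open>T - U\<close> is a sign-reversing involution on the
  interval.\<close>

lemma alternating_sum_interval_eq_0:
  fixes U T :: "'a set"
  assumes "finite T" "U \<subset> T"
  shows "(\<Sum>S | U \<subseteq> S \<and> S \<subseteq> T. (-1) ^ card S) = (0 :: int)"
proof -
  obtain t where t: "t \<in> T" "t \<notin> U" using assms(2) by blast
  define I where "I = {S. U \<subseteq> S \<and> S \<subseteq> T}"
  define \<tau> where "\<tau> S = (if t \<in> S then S - {t} else insert t S)" for S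
  have sgn: "(-1 :: int) ^ card (\<tau> S) = - ((-1) ^ card S)" if "S \<in> I" for S
  proof -
    have fin: "finite S" using that assms(1) finite_subset by (auto simp: I_def)
    show ?thesis
    proof (cases "t \<in> S")
      case True
      then have "card S = Suc (card (S - {t}))"
        using fin by (metis card_Suc_Diff1)
      then have "(-1 :: int) ^ card S = - ((-1) ^ card (S - {t}))" by (metis power_Suc mult_minus1)
      then show ?thesis using True by (simp add: \<tau>_def)
    qed (use fin in \<open>simp add: \<tau>_def\<close>)
  qed
  have "(\<Sum>S\<in>I. (-1 :: int) ^ card S) = (\<Sum>S\<in>I. - ((-1) ^ card S))"
    by (rule sum.reindex_bij_witness[where i = \<tau> and j = \<tau>])
       (use t sgn in \<open>auto simp: \<tau>_def I_def split: if_splits\<close>)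
  then show ?thesis by (simp add: sum_negf I_def)
qed

text \<open>Induction on the number of factors, with \<open>U\<close> left general: expanding one
  factor, its summand at \<open>s\<close> survives only for \<open>S\<close> containing
  \<open>s\<close>, so it trades a factor for the larger lower end
  \<open>insert s U\<close>.\<close>

lemma alternating_sum_prod_affine_eq_0:
  fixes c :: "'k \<Rightarrow> int" and a :: "'k \<Rightarrow> 'a \<Rightarrow> int"
  assumes "finite K" "finite T" "U \<subseteq> T" "card U + card K < card T"
  shows "(\<Sum>S | U \<subseteq> S \<and> S \<subseteq> T. (-1) ^ card S * (\<Prod>k\<in>K. c k + sum (a k) S)) = 0"
  using assms(1,3,4)
proof (induction K arbitrary: U rule: finite_induct)
  case empty
  then have "U \<subset> T" by auto
  with assms(2) show ?case by (simp add: alternating_sum_interval_eq_0)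
next
  case (insert k K)
  define I where "I U = {S. U \<subseteq> S \<and> S \<subseteq> T}" for U
  define g where "g S = (-1) ^ card S * (\<Prod>k\<in>K. c k + sum (a k) S)" for S
  have finI: "finite (I V)" for V
    by (rule finite_subset[of _ "Pow T"]) (auto simp: I_def assms(2))
  have IH: "sum g (I V) = 0" if "V \<subseteq> T" "card V + card K < card T" for V
    using insert.IH[OF that] by (simp add: I_def g_def)
  \<comment> \<open>Summing over the fixed set \<open>T\<close> makes the index range independent of
    \<open>S\<close>, so the two sums can be swapped.\<close>
  have expand: "sum (a k) S = (\<Sum>s\<in>T. if s \<in> S then a k s else 0)" if "S \<in> I U" for S
    using that assms(2) by (simp add: I_def sum.inter_restrict[symmetric] Int_absorb1)
  have "(\<Sum>S\<in>I U. (-1) ^ card S * (\<Prod>k\<in>insert k K. c k + sum (a k) S))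
      = (\<Sum>S\<in>I U. c k * g S + (\<Sum>s\<in>T. if s \<in> S then a k s * g S else 0))"
  proof (rule sum.cong[OF refl])
    fix S assume S: "S \<in> I U"
    have "(-1) ^ card S * (\<Prod>k\<in>insert k K. c k + sum (a k) S) = c k * g S + sum (a k) S * g S"
      using insert.hyps by (simp add: g_def algebra_simps)
    also have "sum (a k) S * g S = (\<Sum>s\<in>T. if s \<in> S then a k s * g S else 0)"
      unfolding expand[OF S] sum_distrib_right by (rule sum.cong) auto
    finally show "(-1) ^ card S * (\<Prod>k\<in>insert k K. c k + sum (a k) S)
        = c k * g S + (\<Sum>s\<in>T. if s \<in> S then a k s * g S else 0)" .
  qed
  also have "\<dots> = c k * sum g (I U) + (\<Sum>s\<in>T. \<Sum>S\<in>I U. if s \<in> S then a k s * g S else 0)"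
    unfolding sum.distrib sum_distrib_left[symmetric] by (subst sum.swap) (rule refl)
  also have "sum g (I U) = 0"
    using insert.prems insert.hyps by (intro IH) auto
  also have "(\<Sum>s\<in>T. \<Sum>S\<in>I U. if s \<in> S then a k s * g S else 0) = 0"
  proof (rule sum.neutral, rule ballI)
    fix s assume "s \<in> T"
    have "(\<Sum>S\<in>I U. if s \<in> S then a k s * g S else 0) = (\<Sum>S\<in>I (insert s U). a k s * g S)"
      by (rule sum.mono_neutral_cong_right) (use finI in \<open>auto simp: I_def\<close>)
    also have "\<dots> = a k s * sum g (I (insert s U))" by (simp add: sum_distrib_left)
    also have "sum g (I (insert s U)) = 0"
    proof (rule IH)
      \<comment> \<open>Only an inequality: \<open>s\<close> may already lie in
        \<open>U\<close>.\<close>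
      have "card (insert s U) \<le> Suc (card U)" by (rule card_insert_le_m1) simp_all
      then show "card (insert s U) + card K < card T"
        using insert.prems insert.hyps by simp
    qed (use insert.prems \<open>s \<in> T\<close> in auto)
    finally show "(\<Sum>S\<in>I U. if s \<in> S then a k s * g S else 0) = 0" by simp
  qed
  finally show ?case by (simp add: I_def)
qed

lemma discrepancy_eq_sum:
  fixes A B :: "nat set"
  assumes "A \<subseteq> {1..n}"
  shows "int (card (A \<inter> B)) - int (card (A \<inter> ({1..n} - B))) = (\<Sum>x\<in>A. if x \<in> B then 1 else -1)"
proof -
  have "finite A" using assms finite_subset by blast
  moreover have "A \<inter> ({1..n} - B) = A \<inter> - B" using assms by auto
  ultimately show ?thesis by (simp add: sum.If_cases)
qed

lemma secting_admissible_card_ge: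
  assumes "1 \<le> i" "i \<le> n" and sect: "secting n {int i} (admissible n i) F'"
  shows "n - i + 1 \<le> 2 * card F'"
proof (rule ccontr)
  assume "\<not> ?thesis"
  then have small: "2 * card F' < n - i + 1" by simp
  define T where "T = {i..n}"
  define W where "W = {1..<i}"
  define e where "e B x = (if x \<in> B then 1 else -1 :: int)" for B and x :: nat
  define h where "h S = (\<Prod>B\<in>F'. sum (e B) W - int i + sum (e B) S)" for S
  have finF: "finite F'"
    using sect finite_subset[of F' "Pow {1..n}"] by (simp add: secting_def)
  have finT: "finite T" and cardT: "card T = n - i + 1"
    using assms by (auto simp: T_def)
  \<comment> \<open>The index set \<open>F' \<times> UNIV\<close> over \<open>bool\<close> lists
    every factor twice, which presents the square as a product of \<open>2 * card F'\<close> affine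
    functions.\<close>
  have prod2: "(\<Prod>k\<in>F' \<times> (UNIV :: bool set).
      (sum (e (fst k)) W - int i) + sum (e (fst k)) S) = (h S)\<^sup>2" for S
  proof -
    have "(\<Prod>k\<in>F' \<times> (UNIV :: bool set). (sum (e (fst k)) W - int i) + sum (e (fst k)) S)
        = (\<Prod>B\<in>F'. \<Prod>b\<in>(UNIV :: bool set). sum (e B) W - int i + sum (e B) S)"
      by (subst prod.cartesian_product) (auto intro!: prod.cong)
    then show ?thesis by (simp add: h_def power2_eq_square prod.distrib)
  qed
  have "(\<Sum>S | {} \<subseteq> S \<and> S \<subseteq> T. (-1) ^ card S * (\<Prod>k\<in>F' \<times> (UNIV :: bool set).
      (sum (e (fst k)) W - int i) + sum (e (fst k)) S)) = 0"
    by (rule alternating_sum_prod_affine_eq_0)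
       (use finF finT cardT small in \<open>auto simp: card_cartesian_product\<close>)
  then have zero: "(\<Sum>S\<in>Pow T. (-1) ^ card S * (h S)\<^sup>2) = 0"
    by (simp only: prod2) (simp add: Pow_def)
  have odd0: "h S = 0" if "S \<in> Pow T" "odd (card S)" for S
  proof -
    have finS: "finite S" using that finT finite_subset by auto
    have disj: "W \<inter> S = {}" using that by (auto simp: W_def T_def)
    have card: "card (W \<union> S) = i - 1 + card S"
      using finS disj by (simp add: card_Un_disjoint W_def)
    have sub: "W \<union> S \<subseteq> {1..n}" using that assms by (auto simp: W_def T_def)
    \<comment> \<open>Being odd, \<open>S\<close> has an element, which lifts the size of
      \<open>W \<union> S\<close> from \<open>i - 1\<close> to at least \<open>i\<close>.\<close>
    have "card S \<noteq> 0" using that(2) by (metis even_zero)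
    moreover have "(i - 1 + card S) mod 2 = i mod 2"
      using that(2) assms(1) by (cases i) (auto simp: mod2_eq_if)
    ultimately have "W \<union> S \<in> admissible n i"
      using sub card by (simp add: admissible_def)
    then obtain B where B: "B \<in> F'"
      and "int (card ((W \<union> S) \<inter> B)) - int (card ((W \<union> S) \<inter> ({1..n} - B))) = int i"
      using sect by (auto simp: secting_def)
    then have "sum (e B) (W \<union> S) = int i"
      using discrepancy_eq_sum[OF sub] by (simp add: e_def[abs_def])
    then have "sum (e B) W - int i + sum (e B) S = 0"
      using finS disj by (simp add: sum.union_disjoint W_def)
    with B finF show ?thesis by (auto simp: h_def)
  qed
  have pos: "h {} \<noteq> 0"
  proof -
    have "sum (e B) W - int i \<noteq> 0" for B
    proof -
      \<comment> \<open>With only \<open>i - 1\<close> elements, \<open>W\<close> cannot reach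
        discrepancy \<open>i\<close>.\<close>
      have "sum (e B) W \<le> (\<Sum>x\<in>W. 1)" by (rule sum_mono) (simp add: e_def)
      then show ?thesis using assms(1) by (simp add: W_def)
    qed
    then show ?thesis using finF by (simp add: h_def)
  qed
  have "0 \<le> (-1) ^ card S * (h S)\<^sup>2" if "S \<in> Pow T" for S
    using odd0[OF that] by (cases "even (card S)") auto
  \<comment> \<open>All terms are nonnegative, so the positive term at the empty set bounds the
    vanishing sum from below.\<close>
  then have "(-1) ^ card ({} :: nat set) * (h {})\<^sup>2 \<le> (\<Sum>S\<in>Pow T. (-1) ^ card S * (h S)\<^sup>2)"
    by (intro member_le_sum) (auto simp: finT)
  with zero pos show False by simp
qed

lemma secting_initial_segments:
  assumes "F \<subseteq> admissible n i"
  shows "secting n {int i} F ((\<lambda>j. {1..j}) ` {i..n})"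
  unfolding secting_def
proof (intro conjI ballI)
  fix A assume "A \<in> F"
  then have A: "A \<subseteq> {1..n}" "card A mod 2 = i mod 2" "i \<le> card A"
    using assms by (auto simp: admissible_def)
  have fin: "finite A" using A(1) finite_subset by blast
  define f where "f j = int (card (A \<inter> {1..j}))" for j
  \<comment> \<open>Discrepancy \<open>i\<close> means that \<open>A'\<close> contains exactly
    \<open>m\<close> elements of \<open>A\<close>, since
    \<open>m - (card A - m) = i\<close>.\<close>
  define m where "m = (card A + i) div 2"
  have m: "2 * m = card A + i" using A(2) unfolding m_def by presburger
  \<comment> \<open>Discrete intermediate value theorem between \<open>f 0 = 0\<close> and
    \<open>f n = card A\<close>.\<close>
  have "\<exists>j\<le>n. f j = int m"
  proof (rule nat_ivt_aux)
    show "\<forall>j<n. \<bar>f (Suc j) - f j\<bar> \<le> 1"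
    proof (intro allI impI)
      fix j
      have "A \<inter> {1..Suc j} = (if Suc j \<in> A then insert (Suc j) (A \<inter> {1..j}) else A \<inter> {1..j})"
        by (auto simp: le_Suc_eq)
      then show "\<bar>f (Suc j) - f j\<bar> \<le> 1" using fin by (simp add: f_def)
    qed
  qed (use A m in \<open>auto simp: f_def Int_absorb2\<close>)
  then obtain j where j: "j \<le> n" "card (A \<inter> {1..j}) = m" by (auto simp: f_def)
  have "card (A \<inter> {1..j}) \<le> card {1..j}" by (rule card_mono) auto
  then have "i \<le> j" using j(2) m A(3) by simp
  have "A \<inter> ({1..n} - {1..j}) = A - A \<inter> {1..j}" using A(1) by auto
  then have "card (A \<inter> ({1..n} - {1..j})) = card A - m"
    using j(2) fin by (simp add: card_Diff_subset)
  then have "int (card (A \<inter> {1..j})) - int (card (A \<inter> ({1..n} - {1..j}))) = int i"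
    using j(2) m A(3) by simp
  then show "\<exists>A'\<in>(\<lambda>j. {1..j}) ` {i..n}.
      int (card (A \<inter> A')) - int (card (A \<inter> ({1..n} - A'))) \<in> {int i}"
    using j(1) \<open>i \<le> j\<close> by auto
qed auto

theorem theorem3:
  fixes n i :: nat
  assumes "n \<ge> 1" and "i \<in> {1..n}"
  shows "(real n - real i + 1) / 2 \<le> real (beta_max n i) \<and>
         real (beta_max n i) \<le> real n - real i + 1"
proof -
  have i: "1 \<le> i" "i \<le> n" using assms(2) by auto
  \<comment> \<open>The minimum is attained because the full power set is secting; the whole
    admissible family witnesses the lower bound.\<close>
  have "beta n {int i} (admissible n i) \<in> {card F' | F'. secting n {int i} (admissible n i) F'}"
    unfolding beta_def by (rule Min_in[OF finite_secting_cards]) (use secting_Pow in blast)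
  then have "n - i + 1 \<le> 2 * beta n {int i} (admissible n i)"
    using secting_admissible_card_ge[OF i] by auto
  moreover have "beta n {int i} (admissible n i) \<le> beta_max n i"
    unfolding beta_max_def by (rule Max_ge[OF finite_beta_values]) auto
  ultimately have lower: "n - i + 1 \<le> 2 * beta_max n i" by simp
  have upper: "beta n {int i} F \<le> n - i + 1" if "F \<subseteq> admissible n i" for F
  proof -
    have "beta n {int i} F \<le> card ((\<lambda>j. {1..j}) ` {i..n})"
      unfolding beta_def
      by (rule Min_le[OF finite_secting_cards]) (use secting_initial_segments[OF that] in blast)
    also have "\<dots> \<le> card {i..n}" by (rule card_image_le) simp
    finally show ?thesis using i by simp
  qed
  have "beta_max n i \<in> {beta n {int i} F | F. F \<subseteq> admissible n i}"
    unfolding beta_max_def by (rule Max_in[OF finite_beta_values]) auto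
  then have "beta_max n i \<le> n - i + 1" using upper by auto
  \<comment> \<open>Truncated subtraction is removed before passing to the reals.\<close>
  then have "n + 1 \<le> 2 * beta_max n i + i" "beta_max n i + i \<le> n + 1"
    using lower i by linarith+
  then have "real (n + 1) \<le> real (2 * beta_max n i + i)" "real (beta_max n i + i) \<le> real (n + 1)"
    by (simp_all only: of_nat_le_iff)
  then show ?thesis by simp
qed

end
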